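(* Let $G=(V,E)$ be a finite directed graph with $V=\{0,\dots,n-1\}$, $n$ odd, in which every vertex has odd in-degree, and let $A=A_G$ be the Majority Boolean Automata Network on $G$. Then $A$ solves the Density Classification Task if and only if $G$ contains none of the following patterns: (i) a leader subset $S\subseteq V$ (of size $|S|<\frac{|V|}{2}$); (ii) a non-empty maximal self-sufficient subset $S\subseteq V$ distinct from $V$; (iii) a self-sufficient $m$-cycle $(S_0,\dots,S_{m-1})$, for some $m\geq 2$ (with $S_i\neq V$ for all $0\le i<m$).
   Context: Directed graphs may have loops. $N_G(v)$ is the set of in-neighbors of $v$ in $G$ (containing $v$ if there is a loop at $v$). For a Boolean vector $y$ of odd length, $\mathtt{maj}(y)\in\{0,1\}$ is the most represented value among its entries. The Majority Boolean Automata Network (MBAN) on $G$ is the map $A_G:\{0,1\}^n\to\{0,1\}^n$ with $A_G(x)_v=\mathtt{maj}(x_{N_G(v)})$ for all $v\in V$, where $x_W$ is the restriction of $x$ to $W\subseteq V$. The MBAN $A$ solves the Density Classification Task (DCT) when for every $x\in\{0,1\}^n$ there is $t\in\mathbb{N}$ such that $A^t(x)=\mathtt{maj}(x)^n$ (the uniform configuration all of whose entries are $\mathtt{maj}(x)$). For $S\subseteq V$, the major of $S$ is $M(S)=\{u\in V : |N_G(u)\cap S|>\frac{|N_G(u)|}{2}\}$. A subset $S$ is a leader when $|S|<\frac{|V|}{2}$ and $|M(S)|>\frac{|V|}{2}$. A subset $S$ is self-sufficient when $S\subseteq M(S)$, and maximal self-sufficient when $S=M(S)$. An $m$-tuple $(S_0,\dots,S_{m-1})$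 of distinct (not necessarily disjoint) subsets of $V$ is a self-sufficient $m$-cycle when $M(S_i)=S_{i+1 \bmod m}$ and $S_i\neq V$ for all $0\le i<m$. *)

theory Defs
  imports Complex_Main "HOL-Library.FuncSet" "Graph_Theory.Graph_Theory"
begin

text \<open>
  Finite directed graphs, possibly with loops and without parallel arcs, are those satisfying the
  locale predicate \<^locale>\<open>pair_fin_digraph\<close>; the pair \<open>(u, v)\<close> is the arc from \<open>u\<close> to \<open>v\<close>.
\<close>

definition in_neighbors :: "'a pair_pre_digraph \<Rightarrow> 'a \<Rightarrow> 'a set" where
  "in_neighbors G v = {u. (u, v) \<in> parcs G}"

text \<open>
  Majority of the restriction of the Boolean vector \<open>x\<close> to the finite index set \<open>W\<close>, where
  \<open>True\<close> stands for 1 and \<open>False\<close> for 0. It is used with \<open>W\<close> of odd size, so ties do not occur.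
\<close>

definition maj :: "'a set \<Rightarrow> ('a \<Rightarrow> bool) \<Rightarrow> bool" where
  "maj W x = (if card {w \<in> W. x w = True} > card {w \<in> W. x w = False} then True else False)"

text \<open>
  Vectors indexed by the vertices are extensional functions, so that equality of configurations
  is equality of their entries on the vertex set.
\<close>

definition configs :: "'a pair_pre_digraph \<Rightarrow> ('a \<Rightarrow> bool) set" where
  "configs G = pverts G \<rightarrow>\<^sub>E (UNIV :: bool set)"

definition uniform_config :: "'a pair_pre_digraph \<Rightarrow> bool \<Rightarrow> 'a \<Rightarrow> bool" where
  "uniform_config G b = (\<lambda>v\<in>pverts G. b)"

definition mban :: "'a pair_pre_digraph \<Rightarrow> ('a \<Rightarrow> bool) \<Rightarrow> 'a \<Rightarrow> bool" where
  "mban G x = (\<lambda>v\<in>pverts G. maj (in_neighbors G v) x)"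

definition solves_DCT :: "'a pair_pre_digraph \<Rightarrow> (('a \<Rightarrow> bool) \<Rightarrow> 'a \<Rightarrow> bool) \<Rightarrow> bool" where
  "solves_DCT G A \<longleftrightarrow>
     (\<forall>x\<in>configs G. \<exists>t::nat. (A ^^ t) x = uniform_config G (maj (pverts G) x))"

definition major :: "'a pair_pre_digraph \<Rightarrow> 'a set \<Rightarrow> 'a set" where
  "major G S =
     {u \<in> pverts G. real (card (in_neighbors G u \<inter> S)) > real (card (in_neighbors G u)) / 2}"

definition leader :: "'a pair_pre_digraph \<Rightarrow> 'a set \<Rightarrow> bool" where
  "leader G S \<longleftrightarrow>
     S \<subseteq> pverts G \<and> real (card S) < real (card (pverts G)) / 2 \<and>
     real (card (major G S)) > real (card (pverts G)) / 2"

definition maximal_self_sufficient :: "'a pair_pre_digraph \<Rightarrow> 'a set \<Rightarrow> bool" where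
  "maximal_self_sufficient G S \<longleftrightarrow> S \<subseteq> pverts G \<and> S = major G S"

definition self_sufficient_cycle :: "'a pair_pre_digraph \<Rightarrow> nat \<Rightarrow> 'a set list \<Rightarrow> bool" where
  "self_sufficient_cycle G m Ss \<longleftrightarrow>
     length Ss = m \<and> distinct Ss \<and>
     (\<forall>i<m. Ss ! i \<subseteq> pverts G \<and> major G (Ss ! i) = Ss ! ((i + 1) mod m) \<and> Ss ! i \<noteq> pverts G)"

end

theory Submission
  imports Defs
begin

text \<open>
  Identifying a configuration with the set of vertices in state 1 turns the MBAN into the map
  \<open>S \<mapsto> M(S)\<close> on subsets of \<open>V\<close>, which commutes with complement because all
  in-degrees are odd, and which fixes \<open>{}\<close> and \<open>V\<close>. Each orbit of this finite system ends in a
  cycle; patterns (ii) and (iii) are exactly the cycles other than these two fixed points, and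
  without leaders (i) the majority value never changes along an orbit.
\<close>

section \<open>Orbits of a self-map of a finite set\<close>

lemma eventually_periodic:
  assumes "finite A" "f ` A \<subseteq> A" "x \<in> A"
  obtains i p where "p > 0" "(f ^^ p) ((f ^^ i) x) = (f ^^ i) x"
proof -
  have "(f ^^ i) x \<in> A" for i
    using assms by (induction i) auto
  then have "finite (range (\<lambda>i. (f ^^ i) x))"
    using assms(1) finite_subset[of "range (\<lambda>i. (f ^^ i) x)" A] by blast
  \<comment> \<open>Pigeonhole: infinitely many times, finitely many values. Two times
    \<open>i < j\<close> with the same iterate give the period \<open>j - i\<close>.\<close>
  then have "\<not> inj (\<lambda>i. (f ^^ i) x)"
    using finite_imageD infinite_UNIV_nat by blast
  then obtain i j where "(f ^^ i) x = (f ^^ j) x" "i < j"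
    using linorder_injI[of "\<lambda>i. (f ^^ i) x"] by blast
  then have "(f ^^ (j - i)) ((f ^^ i) x) = (f ^^ i) x"
    by (metis add.commute add_diff_inverse_nat comp_apply funpow_add not_less_iff_gr_or_eq)
  with \<open>i < j\<close> show thesis
    by (intro that[of "j - i" i]) auto
qed

text \<open>If the iterates at \<open>a < b < p\<close> agreed, applying \<open>f\<close> another
  \<open>p - b\<close> times would bring \<open>x\<close> back to itself at time
  \<open>p - b + a\<close>, which lies strictly between 0 and \<open>p\<close>.\<close>

lemma distinct_orbit_of_least_period:
  assumes "(f ^^ p) x = x" "\<And>q. 0 < q \<Longrightarrow> q < p \<Longrightarrow> (f ^^ q) x \<noteq> x"
  shows "distinct (map (\<lambda>i. (f ^^ i) x) [0..<p])"
proof -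
  have "(f ^^ a) x \<noteq> (f ^^ b) x" if "a < b" "b < p" for a b
  proof
    assume "(f ^^ a) x = (f ^^ b) x"
    then have "(f ^^ (p - b + a)) x = (f ^^ (p - b + b)) x"
      by (simp add: funpow_add)
    then show False
      using assms that by auto
  qed
  then have "inj_on (\<lambda>i. (f ^^ i) x) {0..<p}"
    by (intro linorder_inj_onI) auto
  then show ?thesis
    by (simp add: distinct_map)
qed

text \<open>The library in-degree counts arcs. As arcs are pairs, there are no parallel ones, and
  each arc into \<open>v\<close> is determined by its tail.\<close>

lemma card_in_neighbors:
  assumes "pair_wf_digraph G"
  shows "card (in_neighbors G v) = in_degree (with_proj G) v"
proof -
  have "in_arcs (with_proj G) v = (\<lambda>u. (u, v)) ` in_neighbors G v"
    by (auto simp: in_arcs_def in_neighbors_def)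
  then show ?thesis
    by (simp add: in_degree_def card_image inj_on_def)
qed

section \<open>Configurations as vertex sets\<close>

definition true_set :: "'a pair_pre_digraph \<Rightarrow> ('a \<Rightarrow> bool) \<Rightarrow> 'a set" where
  "true_set G x = {v \<in> pverts G. x v}"

lemma true_set_restrict: "S \<subseteq> pverts G \<Longrightarrow> true_set G (\<lambda>v\<in>pverts G. v \<in> S) = S"
  by (auto simp: true_set_def)

text \<open>Injectivity rests on extensionality: configurations that agree on the vertices also
  agree outside them.\<close>

lemma true_set_eq_iff:
  assumes "x \<in> configs G" "y \<in> configs G"
  shows "true_set G x = true_set G y \<longleftrightarrow> x = y"
proof
  assume "true_set G x = true_set G y"
  then have "x v = y v" if "v \<in> pverts G" for v
    using that by (auto simp: true_set_def)
  then show "x = y"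
    using assms by (auto simp: configs_def intro: PiE_ext)
qed simp

lemma uniform_config_in_configs: "uniform_config G b \<in> configs G"
  by (simp add: uniform_config_def configs_def)

lemma true_set_uniform_config: "true_set G (uniform_config G b) = (if b then pverts G else {})"
  by (auto simp: true_set_def uniform_config_def)

lemma mban_in_configs: "mban G x \<in> configs G"
  by (simp add: mban_def configs_def)

lemma funpow_mban_in_configs: "x \<in> configs G \<Longrightarrow> (mban G ^^ t) x \<in> configs G"
  by (induction t) (auto simp: mban_in_configs)

lemma major_subset: "major G S \<subseteq> pverts G"
  by (auto simp: major_def)

lemma funpow_major_subset: "S \<subseteq> pverts G \<Longrightarrow> (major G ^^ t) S \<subseteq> pverts G"
  by (induction t) (simp_all add: major_subset)

text \<open>Brings \<open>maj\<close> to the strict threshold form shared with \<open>major\<close>;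
  the false entries are counted as the complement of the true ones.\<close>

lemma maj_iff:
  assumes "finite W"
  shows "maj W x \<longleftrightarrow> 2 * card {w \<in> W. x w} > card W"
proof -
  have "card W = card {w \<in> W. x w} + card {w \<in> W. \<not> x w}"
    using assms by (subst card_Un_disjoint[symmetric]) (auto intro: arg_cong[where f = card])
  then show ?thesis
    by (simp add: maj_def)
qed

lemma half_less_real_iff: "real b / 2 < real a \<longleftrightarrow> b < 2 * a"
  by linarith

lemma less_half_real_iff: "real a < real b / 2 \<longleftrightarrow> 2 * a < b"
  by linarith

lemma mem_major_iff:
  "u \<in> major G S \<longleftrightarrow>
     u \<in> pverts G \<and> 2 * card (in_neighbors G u \<inter> S) > card (in_neighbors G u)"
  unfolding major_def half_less_real_iff by simp

lemma leader_iff: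
  "leader G S \<longleftrightarrow> S \<subseteq> pverts G \<and> 2 * card S < card (pverts G) \<and>
     2 * card (major G S) > card (pverts G)"
  unfolding leader_def half_less_real_iff less_half_real_iff by simp

section \<open>The majority map on vertex sets under odd in-degrees\<close>

locale odd_in_digraph = pair_fin_digraph G for G :: "'a pair_pre_digraph" +
  assumes odd_in: "v \<in> pverts G \<Longrightarrow> odd (card (in_neighbors G v))"
begin

lemma in_neighbors_subset: "in_neighbors G v \<subseteq> pverts G"
  by (auto simp: in_neighbors_def dest: in_arcsD1)

lemma finite_in_neighbors: "finite (in_neighbors G v)"
  by (rule finite_subset[OF in_neighbors_subset pair_finite_verts])

text \<open>In-neighbors are vertices, so intersecting with \<open>true_set G x\<close> keeps
  exactly the in-neighbors in state 1. Hence \<open>true_set\<close> intertwines the two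
  dynamics.\<close>

lemma true_set_mban: "true_set G (mban G x) = major G (true_set G x)"
proof -
  have "{w \<in> in_neighbors G v. x w} = in_neighbors G v \<inter> true_set G x" for v
    using in_neighbors_subset by (auto simp: true_set_def)
  then show ?thesis
    by (subst true_set_def) (auto simp: mban_def mem_major_iff maj_iff[OF finite_in_neighbors])
qed

lemma true_set_funpow_mban: "true_set G ((mban G ^^ t) x) = (major G ^^ t) (true_set G x)"
  by (induction t) (auto simp: true_set_mban)

text \<open>An odd in-neighborhood admits no tie, so exactly one of \<open>S\<close> and its
  complement holds a strict majority in it.\<close>

lemma major_compl:
  assumes "S \<subseteq> pverts G"
  shows "major G (pverts G - S) = pverts G - major G S"
proof -
  have "u \<in> major G (pverts G - S) \<longleftrightarrow> u \<notin> major G S" if u: "u \<in> pverts G" for u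
  proof -
    have "in_neighbors G u \<inter> (pverts G - S) = in_neighbors G u - in_neighbors G u \<inter> S"
      using in_neighbors_subset by auto
    then have "card (in_neighbors G u \<inter> (pverts G - S)) + card (in_neighbors G u \<inter> S)
        = card (in_neighbors G u)"
      by (simp add: card_Diff_subset finite_in_neighbors card_mono)
    moreover have "2 * card (in_neighbors G u \<inter> S) \<noteq> card (in_neighbors G u)"
      using odd_in[OF u] by (metis dvd_triv_left)
    ultimately show ?thesis
      using u by (auto simp: mem_major_iff)
  qed
  then show ?thesis
    using major_subset[of G S] major_subset[of G "pverts G - S"] by blast
qed

lemma major_empty: "major G {} = {}"
  by (auto simp: mem_major_iff)

lemma major_verts: "major G (pverts G) = pverts G"
  using major_compl[of "{}"] by (simp add: major_empty)

lemma funpow_major_empty: "(major G ^^ t) {} = {}"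
  by (induction t) (auto simp: major_empty)

lemma funpow_major_verts: "(major G ^^ t) (pverts G) = pverts G"
  by (induction t) (auto simp: major_verts)

text \<open>This is the set of ones of the uniform configuration that the task prescribes for an
  input whose set of ones is \<open>S\<close>.\<close>

definition target :: "'a set \<Rightarrow> 'a set" where
  "target S = (if 2 * card S > card (pverts G) then pverts G else {})"

lemma solves_DCT_mban_iff:
  "solves_DCT G (mban G) \<longleftrightarrow> (\<forall>S\<subseteq>pverts G. \<exists>t. (major G ^^ t) S = target S)"
proof -
  have *: "(mban G ^^ t) x = uniform_config G (maj (pverts G) x) \<longleftrightarrow>
      (major G ^^ t) (true_set G x) = target (true_set G x)" if "x \<in> configs G" for x t
  proof -
    have "maj (pverts G) x \<longleftrightarrow> 2 * card (true_set G x) > card (pverts G)"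
      by (simp add: maj_iff true_set_def)
    then show ?thesis
      by (simp add: true_set_eq_iff[OF funpow_mban_in_configs[OF that] uniform_config_in_configs,
            symmetric] true_set_funpow_mban true_set_uniform_config target_def)
  qed
  \<comment> \<open>Surjectivity of \<open>true_set\<close> turns quantification over configurations
    into quantification over subsets.\<close>
  have "\<exists>x\<in>configs G. true_set G x = S" if "S \<subseteq> pverts G" for S
    using true_set_restrict[OF that] by (intro bexI) (auto simp: configs_def)
  moreover have "true_set G x \<subseteq> pverts G" for x
    by (auto simp: true_set_def)
  ultimately show ?thesis
    unfolding solves_DCT_def using * by metis
qed

section \<open>Convergence in the absence of the three patterns\<close>

lemma fixed_or_cycle:
  assumes S: "S \<subseteq> pverts G"
    and no_fix: "\<not> (\<exists>S. S \<noteq> {} \<and> maximal_self_sufficient G S \<and> S \<noteq> pverts G)"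
    and no_cycle: "\<not> (\<exists>m\<ge>2. \<exists>Ss. self_sufficient_cycle G m Ss)"
  shows "\<exists>t. (major G ^^ t) S = {} \<or> (major G ^^ t) S = pverts G"
proof -
  obtain i p where "p > 0" "(major G ^^ p) ((major G ^^ i) S) = (major G ^^ i) S"
    by (rule eventually_periodic[of "Pow (pverts G)" "major G" S]) (use S in \<open>auto dest: subsetD[OF major_subset]\<close>)
  moreover define T where "T = (major G ^^ i) S"
  ultimately have ex: "\<exists>p. p > 0 \<and> (major G ^^ p) T = T"
    by blast
  \<comment> \<open>A cycle must list distinct sets, so an arbitrary period of \<open>T\<close>
    would not do.\<close>
  define p where "p = (LEAST p. p > 0 \<and> (major G ^^ p) T = T)"
  have p: "p > 0" "(major G ^^ p) T = T"
    using LeastI_ex[OF ex] by (auto simp: p_def)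
  have p_least: "(major G ^^ q) T \<noteq> T" if "0 < q" "q < p" for q
    using that not_less_Least[of q] by (auto simp: p_def)
  have T: "T \<subseteq> pverts G"
    unfolding T_def using funpow_major_subset[OF S] .
  \<comment> \<open>With a least period of at least 2, the orbit of \<open>T\<close> would itself be
    a forbidden self-sufficient cycle.\<close>
  have "p = 1"
  proof (rule ccontr)
    assume "p \<noteq> 1"
    with p have "p \<ge> 2" by simp
    \<comment> \<open>The full vertex set is fixed, so an orbit that meets it stays there. By
      periodicity \<open>T\<close> would be that set, with period 1.\<close>
    have ne: "(major G ^^ j) T \<noteq> pverts G" if "j < p" for j
    proof
      assume "(major G ^^ j) T = pverts G"
      then have "(major G ^^ (p - j + j)) T = pverts G"
        by (simp only: funpow_add comp_apply funpow_major_verts)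
      with p that have "T = pverts G" by simp
      then show False
        using p_least[of 1] \<open>p \<ge> 2\<close> by (simp add: major_verts)
    qed
    have step: "major G ((major G ^^ j) T) = (major G ^^ (Suc j mod p)) T" if "j < p" for j
    proof -
      have "(major G ^^ Suc j) T = (major G ^^ (Suc j mod p)) T"
      proof (cases "Suc j = p")
        case True
        then show ?thesis
          using p(2) by simp
      next
        case False
        with that have "Suc j < p" by simp
        then show ?thesis
          by (simp only: mod_less)
      qed
      then show ?thesis by simp
    qed
    have "distinct (map (\<lambda>j. (major G ^^ j) T) [0..<p])"
      by (rule distinct_orbit_of_least_period) (fact p(2), fact p_least)
    then have "self_sufficient_cycle G p (map (\<lambda>j. (major G ^^ j) T) [0..<p])"
      using ne step funpow_major_subset[OF T] p(1) by (simp add: self_sufficient_cycle_def)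
    with no_cycle \<open>p \<ge> 2\<close> show False by blast
  qed
  with p have "maximal_self_sufficient G T"
    using T by (simp add: maximal_self_sufficient_def)
  with no_fix show ?thesis
    unfolding T_def by blast
qed

text \<open>A minority set with a majority image would be a leader, and odd order excludes an image
  of exactly half the vertices.\<close>

lemma minority_funpow_major:
  assumes "odd (card (pverts G))" "\<not> (\<exists>S. leader G S)"
    and "S \<subseteq> pverts G" "2 * card S < card (pverts G)"
  shows "2 * card ((major G ^^ t) S) < card (pverts G)"
proof (induction t)
  case (Suc t)
  then have "\<not> 2 * card (major G ((major G ^^ t) S)) > card (pverts G)"
    using assms funpow_major_subset[of S G t] by (auto simp: leader_iff)
  moreover have "2 * card (major G ((major G ^^ t) S)) \<noteq> card (pverts G)"
    using assms(1) by (metis dvd_triv_left)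
  ultimately show ?case by simp
qed (use assms in simp)

lemma funpow_major_compl:
  assumes "S \<subseteq> pverts G"
  shows "(major G ^^ t) (pverts G - S) = pverts G - (major G ^^ t) S"
  by (induction t) (use assms in \<open>auto simp: major_compl funpow_major_subset\<close>)

text \<open>Minority sets remain minorities, so of the two possible limits only the empty set is
  left. Majority sets follow by passing to complements, which commutes with iteration.\<close>

lemma reaches_target:
  assumes "odd (card (pverts G))" "\<not> (\<exists>S. leader G S)"
    and "\<not> (\<exists>S. S \<noteq> {} \<and> maximal_self_sufficient G S \<and> S \<noteq> pverts G)"
    and "\<not> (\<exists>m\<ge>2. \<exists>Ss. self_sufficient_cycle G m Ss)"
    and S: "S \<subseteq> pverts G"
  shows "\<exists>t. (major G ^^ t) S = target S"
proof -
  have minority: "\<exists>t. (major G ^^ t) S = {}"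
    if S: "S \<subseteq> pverts G" "2 * card S < card (pverts G)" for S
  proof -
    obtain t where "(major G ^^ t) S = {} \<or> (major G ^^ t) S = pverts G"
      using fixed_or_cycle[OF S(1) assms(3,4)] by blast
    moreover have "2 * card ((major G ^^ t) S) < card (pverts G)"
      using minority_funpow_major[OF assms(1,2) S] .
    ultimately show ?thesis by auto
  qed
  show ?thesis
  proof (cases "2 * card S > card (pverts G)")
    case True
    moreover have "card (pverts G - S) + card S = card (pverts G)"
      using S by (simp add: card_Diff_subset finite_subset[OF S] card_mono)
    ultimately obtain t where "(major G ^^ t) (pverts G - S) = {}"
      using minority[of "pverts G - S"] by auto
    then have "(major G ^^ t) S = pverts G"
      using funpow_major_compl[OF S] funpow_major_subset[OF S] by blast
    with True show ?thesis
      by (auto simp: target_def)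
  next
    case False
    moreover have "2 * card S \<noteq> card (pverts G)"
      using assms(1) by (metis dvd_triv_left)
    ultimately show ?thesis
      using minority[OF S] by (simp add: target_def)
  qed
qed

section \<open>The three patterns as obstructions to classification\<close>

lemma cycle_funpow:
  assumes "self_sufficient_cycle G m Ss" "m \<ge> 2"
  shows "(major G ^^ t) (Ss ! 0) = Ss ! (t mod m)"
proof (induction t)
  case (Suc t)
  have "t mod m < m"
    using assms(2) by simp
  with Suc assms(1) show ?case
    by (simp add: self_sufficient_cycle_def mod_Suc_eq)
qed simp

theorem solves_DCT_mban_iff_no_pattern:
  assumes odd_verts: "odd (card (pverts G))"
  shows "solves_DCT G (mban G) \<longleftrightarrow>
    \<not> (\<exists>S. leader G S) \<and>
    \<not> (\<exists>S. S \<noteq> {} \<and> maximal_self_sufficient G S \<and> S \<noteq> pverts G) \<and>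
    \<not> (\<exists>m\<ge>2. \<exists>Ss. self_sufficient_cycle G m Ss)"
proof
  assume "solves_DCT G (mban G)"
  then have reach: "\<exists>t. (major G ^^ t) S = target S" if "S \<subseteq> pverts G" for S
    using that solves_DCT_mban_iff by blast
  have nonempty: "pverts G \<noteq> {}"
    using odd_verts by auto
  have "\<not> leader G S" for S
  proof
    assume leader: "leader G S"
    then obtain t where "(major G ^^ t) S = {}"
      using reach[of S] by (auto simp: leader_iff target_def)
    moreover obtain s where "(major G ^^ s) (major G S) = pverts G"
      using leader reach[OF major_subset, of S] by (auto simp: leader_iff target_def)
    then have "(major G ^^ Suc s) S = pverts G"
      by (simp add: funpow_swap1)
    \<comment> \<open>The orbit of a leader reaches the empty set, while that of its major reaches
      all vertices. Both are fixed, so continuing to a common time makes them equal.\<close>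
    ultimately have "(major G ^^ (t + Suc s)) S = pverts G" "(major G ^^ (Suc s + t)) S = {}"
      by (simp_all only: funpow_add comp_apply funpow_major_verts funpow_major_empty)
    with nonempty show False
      by (simp add: add.commute)
  qed
  moreover have "S = {} \<or> S = pverts G" if "maximal_self_sufficient G S" for S
  proof -
    have "(major G ^^ t) S = S" for t
      using that by (induction t) (auto simp: maximal_self_sufficient_def)
    then show ?thesis
      using reach[of S] that by (auto simp: maximal_self_sufficient_def target_def split: if_splits)
  qed
  moreover have "\<not> self_sufficient_cycle G m Ss" if m: "m \<ge> 2" for m Ss
  proof
    assume cyc: "self_sufficient_cycle G m Ss"
    then have "Ss ! 0 \<subseteq> pverts G"
      using m by (simp add: self_sufficient_cycle_def)
    then obtain t where "Ss ! (t mod m) = target (Ss ! 0)"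
      using reach cycle_funpow[OF cyc m] by metis
    moreover have less: "t mod m < m" "Suc t mod m < m"
      using m by simp_all
    \<comment> \<open>The other possible target, the full vertex set, is not an entry of a
      cycle.\<close>
    ultimately have "Ss ! (t mod m) = {}"
      using cyc by (auto simp: self_sufficient_cycle_def target_def split: if_splits)
    \<comment> \<open>The empty set is fixed, so the next entry is empty too, against distinctness
      of the entries when \<open>m \<ge> 2\<close>.\<close>
    then have "Ss ! (Suc t mod m) = Ss ! (t mod m)"
      using cycle_funpow[OF cyc m, of t] cycle_funpow[OF cyc m, of "Suc t"]
      by (simp add: major_empty)
    then have "Suc t mod m = t mod m"
      using cyc less by (simp add: self_sufficient_cycle_def nth_eq_iff_index_eq)
    then show False
      using m by (auto simp: mod_Suc split: if_splits)
  qed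
  ultimately show "\<not> (\<exists>S. leader G S) \<and>
    \<not> (\<exists>S. S \<noteq> {} \<and> maximal_self_sufficient G S \<and> S \<noteq> pverts G) \<and>
    \<not> (\<exists>m\<ge>2. \<exists>Ss. self_sufficient_cycle G m Ss)"
    by blast
next
  assume "\<not> (\<exists>S. leader G S) \<and>
    \<not> (\<exists>S. S \<noteq> {} \<and> maximal_self_sufficient G S \<and> S \<noteq> pverts G) \<and>
    \<not> (\<exists>m\<ge>2. \<exists>Ss. self_sufficient_cycle G m Ss)"
  then show "solves_DCT G (mban G)"
    unfolding solves_DCT_mban_iff using reaches_target[OF odd_verts] by simp
qed

end

theorem theorem4p9:
  fixes G :: "nat pair_pre_digraph" and n :: nat
  assumes "pair_fin_digraph G"
    and "pverts G = {0..<n}"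
    and "odd n"
    and "\<forall>v\<in>pverts G. odd (in_degree (with_proj G) v)"
  shows "solves_DCT G (mban G) \<longleftrightarrow>
    \<not> (\<exists>S. leader G S) \<and>
    \<not> (\<exists>S. S \<noteq> {} \<and> maximal_self_sufficient G S \<and> S \<noteq> pverts G) \<and>
    \<not> (\<exists>m\<ge>2. \<exists>Ss. self_sufficient_cycle G m Ss)"
proof -
  interpret pair_fin_digraph G
    by fact
  interpret odd_in_digraph G
    by unfold_locales (use assms(4) card_in_neighbors[OF pair_wf_digraph_axioms] in simp)
  show ?thesis
    using solves_DCT_mban_iff_no_pattern assms(2,3) by simp
qed

end
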